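(* Let $0<\varphi\le\frac{\pi}{2}$, $c=\cos\varphi$, $s=\sin\varphi=\sqrt{1-c^2}$. Put $$g_1(\xi)=2187\xi^3+3807c\,\xi^2+(1953c^2-3840)\xi+245c^3-4352c,$$ $$g_2(\xi,\eta)=-8(1-c^2)\eta+\sqrt{1-c^2}\,\bigl(27\xi^2+10c\,\xi+3c^2-40\bigr),$$ $$I=\left(\tfrac{1}{27}\bigl(-5c+8\sqrt2\sqrt{9-c^2}\bigr),\ \tfrac{4-c}{3}\right),\qquad J=\left(\tfrac{\sqrt{1-c^2}}{3},\ \tfrac{3-c}{1+c}\cdot\tfrac{\sqrt{1-c^2}}{3}\right).$$ Then the optimal inner cubic $G^0$ approximant of the circular arc $\alpha\mapsto(\cos\alpha,\sin\alpha)^T$, $\alpha\in[-\varphi,\varphi]$, is given by the pair of parameters $(\xi^\lor,\eta^\lor)\in I\times J$, where $\xi^\lor$ is the unique zero of $g_1$ in $I$ and $\eta^\lor$ is the unique zero of $g_2(\xi^\lor,\cdot)$ in $J$.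
   Context: For real $\xi>0$ and $\eta\in\mathbb{R}$, the cubic $G^0$ approximant with parameters $(\xi,\eta)$ is the curve $p:[-1,1]\to\mathbb{R}^2$, $p(t)=\sum_{i=0}^3\binom{3}{i}\left(\frac{1+t}{2}\right)^i\left(\frac{1-t}{2}\right)^{3-i}b_i$, with control points $b_0=(c,-s)$, $b_1=(\xi,-\eta)$, $b_2=(\xi,\eta)$, $b_3=(c,s)$. Its simplified radial error function is $\psi(t,\xi,\eta)=\|p(t)\|_2^2-1$. The approximant is called inner if $\psi(t,\xi,\eta)\le 0$ for all $t\in[-1,1]$. An inner approximant is optimal if it minimizes $\max_{t\in[-1,1]}|\psi(t,\xi,\eta)|$ among all inner approximants of this form (all $\xi>0$, $\eta\in\mathbb{R}$ giving an inner approximant). *)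

theory Defs
  imports "HOL-Analysis.Analysis"
begin

text \<open>
  The arc is \<open>\<alpha> \<mapsto> (cos \<alpha>, sin \<alpha>)\<close> for \<open>\<alpha> \<in> [-\<phi>, \<phi>]\<close>. The first and the last control point
  are its endpoints, which is the \<open>G\<^sup>0\<close> condition.
\<close>

definition control_point :: "real \<Rightarrow> real \<Rightarrow> real \<Rightarrow> nat \<Rightarrow> real ^ 2" where
  "control_point \<phi> \<xi> \<eta> i =
     [vector [cos \<phi>, - sin \<phi>], vector [\<xi>, - \<eta>], vector [\<xi>, \<eta>], vector [cos \<phi>, sin \<phi>]] ! i"

definition cubic_approximant :: "real \<Rightarrow> real \<Rightarrow> real \<Rightarrow> real \<Rightarrow> real ^ 2" where
  "cubic_approximant \<phi> \<xi> \<eta> t =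
     (\<Sum>i\<le>3. (real (3 choose i) * ((1 + t) / 2) ^ i * ((1 - t) / 2) ^ (3 - i))
              *\<^sub>R control_point \<phi> \<xi> \<eta> i)"

definition radial_error :: "real \<Rightarrow> real \<Rightarrow> real \<Rightarrow> real \<Rightarrow> real" where
  "radial_error \<phi> t \<xi> \<eta> = (norm (cubic_approximant \<phi> \<xi> \<eta> t))\<^sup>2 - 1"

definition max_radial_error :: "real \<Rightarrow> real \<Rightarrow> real \<Rightarrow> real" where
  "max_radial_error \<phi> \<xi> \<eta> = (SUP t\<in>{-1..1}. \<bar>radial_error \<phi> t \<xi> \<eta>\<bar>)"

text \<open>The supremum is a maximum.\<close>

lemma max_radial_error_attained:
  "\<exists>t\<in>{-1..1}. max_radial_error \<phi> \<xi> \<eta> = \<bar>radial_error \<phi> t \<xi> \<eta>\<bar> \<and>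
     (\<forall>t'\<in>{-1..1}. \<bar>radial_error \<phi> t' \<xi> \<eta>\<bar> \<le> \<bar>radial_error \<phi> t \<xi> \<eta>\<bar>)"
proof -
  have "continuous_on {-1..1} (\<lambda>t. \<bar>radial_error \<phi> t \<xi> \<eta>\<bar>)"
    unfolding radial_error_def cubic_approximant_def by (intro continuous_intros) auto
  then obtain t where t: "t \<in> {-1..1}"
    and le: "\<forall>t'\<in>{-1..1}. \<bar>radial_error \<phi> t' \<xi> \<eta>\<bar> \<le> \<bar>radial_error \<phi> t \<xi> \<eta>\<bar>"
    using continuous_attains_sup[of "{-1..1::real}" "\<lambda>t. \<bar>radial_error \<phi> t \<xi> \<eta>\<bar>"] by auto
  have "max_radial_error \<phi> \<xi> \<eta> = \<bar>radial_error \<phi> t \<xi> \<eta>\<bar>"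
    unfolding max_radial_error_def by (rule cSup_eq_maximum) (use t le in auto)
  with t le show ?thesis by blast
qed

definition inner_approximant :: "real \<Rightarrow> real \<Rightarrow> real \<Rightarrow> bool" where
  "inner_approximant \<phi> \<xi> \<eta> \<longleftrightarrow> \<xi> > 0 \<and> (\<forall>t\<in>{-1..1}. radial_error \<phi> t \<xi> \<eta> \<le> 0)"

definition optimal_inner_approximant :: "real \<Rightarrow> real \<Rightarrow> real \<Rightarrow> bool" where
  "optimal_inner_approximant \<phi> \<xi> \<eta> \<longleftrightarrow>
     inner_approximant \<phi> \<xi> \<eta> \<and>
     (\<forall>\<xi>' \<eta>'. inner_approximant \<phi> \<xi>' \<eta>' \<longrightarrow> max_radial_error \<phi> \<xi> \<eta> \<le> max_radial_error \<phi> \<xi>' \<eta>')"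

definition g1 :: "real \<Rightarrow> real \<Rightarrow> real" where
  "g1 c \<xi> = 2187 * \<xi> ^ 3 + 3807 * c * \<xi>\<^sup>2 + (1953 * c\<^sup>2 - 3840) * \<xi> + 245 * c ^ 3 - 4352 * c"

definition g2 :: "real \<Rightarrow> real \<Rightarrow> real \<Rightarrow> real" where
  "g2 c \<xi> \<eta> = - 8 * (1 - c\<^sup>2) * \<eta> + sqrt (1 - c\<^sup>2) * (27 * \<xi>\<^sup>2 + 10 * c * \<xi> + 3 * c\<^sup>2 - 40)"

definition xi_interval :: "real \<Rightarrow> real set" where
  "xi_interval c = {(1 / 27) * (- 5 * c + 8 * sqrt 2 * sqrt (9 - c\<^sup>2)) <..< (4 - c) / 3}"

definition eta_interval :: "real \<Rightarrow> real set" where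
  "eta_interval c = {sqrt (1 - c\<^sup>2) / 3 <..< (3 - c) / (1 + c) * (sqrt (1 - c\<^sup>2) / 3)}"

end

(*
  Put a = 3 (xi - c) / 4, b = (3 eta - s) / 4 and w = 1 - t^2. The radial error is
  (c + a w)^2 + (1 - w) (s + b w)^2 - 1, a cubic in w that vanishes at w = 0 and has leading
  coefficient - b^2. The candidate is the one for which it is a Chebyshev polynomial:
  - b^2 w (w - 3/4)^2, with maximum 0 at w = 0, 3/4 and minimum - b^2/16 at w = 1/4, 1.
  Comparing coefficients gives two equations for (a, b); eliminating b yields g1 = 0 and g2 = 0.
  A competitor (x, y) that is inner and has no larger error satisfies one inequality at each of
  w = 1, 3/4, 1/4. The first gives x >= a, the second then gives y <= b, and three times the third
  plus the second gives a (x - a) + (x - a)^2/2 + s (b - y) <= 0, so (x, y) = (a, b).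
*)

theory Submission
  imports Defs
begin

section \<open>The radial error as a cubic in \<open>1 - t\<^sup>2\<close>\<close>

lemma radial_error_eq:
  "radial_error \<phi> t \<xi> \<eta> =
     (cos \<phi> + 3 * (\<xi> - cos \<phi>) / 4 * (1 - t\<^sup>2))\<^sup>2 +
     t\<^sup>2 * (sin \<phi> + (3 * \<eta> - sin \<phi>) / 4 * (1 - t\<^sup>2))\<^sup>2 - 1"
proof -
  have px: "cubic_approximant \<phi> \<xi> \<eta> t $ 1 = cos \<phi> + 3 * (\<xi> - cos \<phi>) / 4 * (1 - t\<^sup>2)"
    and py: "cubic_approximant \<phi> \<xi> \<eta> t $ 2 = t * (sin \<phi> + (3 * \<eta> - sin \<phi>) / 4 * (1 - t\<^sup>2))"
    unfolding cubic_approximant_def control_point_def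
    by (simp_all add: atMost_Suc eval_nat_numeral field_simps)
  have "(norm (cubic_approximant \<phi> \<xi> \<eta> t))\<^sup>2
      = (cubic_approximant \<phi> \<xi> \<eta> t $ 1)\<^sup>2 + (cubic_approximant \<phi> \<xi> \<eta> t $ 2)\<^sup>2"
    by (simp add: norm_vec_def L2_set_def sum_2)
  then show ?thesis
    unfolding radial_error_def px py by (simp add: power_mult_distrib)
qed

text \<open>The two equations on \<open>a\<close> and \<open>b\<close> say that the coefficients of
  w^2 and w are 3/2 b^2 and -9/16 b^2, as in the expansion of -b^2 w (w - 3/4)^2.\<close>

lemma radial_error_chebyshev:
  fixes a b c s t :: real
  assumes "s\<^sup>2 + c\<^sup>2 = 1"
    and "a\<^sup>2 = 2 * s * b + b\<^sup>2 / 2" and "2 * c * a + 2 * s * b - s\<^sup>2 = - (9 / 16) * b\<^sup>2"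
  shows "(c + a * (1 - t\<^sup>2))\<^sup>2 + t\<^sup>2 * (s + b * (1 - t\<^sup>2))\<^sup>2 - 1
       = - (b\<^sup>2 * (1 - t\<^sup>2) * (1 / 4 - t\<^sup>2)\<^sup>2)"
proof -
  define w where "w = 1 - t\<^sup>2"
  have t: "t\<^sup>2 = 1 - w" by (simp add: w_def)
  have "(c + a * w)\<^sup>2 + (1 - w) * (s + b * w)\<^sup>2 - 1
      = (s\<^sup>2 + c\<^sup>2 - 1) + w * (2 * c * a + 2 * s * b - s\<^sup>2) + w\<^sup>2 * (a\<^sup>2 + b\<^sup>2 - 2 * s * b) - b\<^sup>2 * w ^ 3"
    by algebra
  also have "\<dots> = - (b\<^sup>2 * w * (1 / 4 - (1 - w))\<^sup>2)"
    unfolding assms by (simp add: field_simps power2_eq_square power3_eq_cube)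
  finally show ?thesis unfolding t by simp
qed

text \<open>The polynomial is (1 + T_3(2w - 1)) / 32 with T_3 the Chebyshev polynomial of degree
  3.\<close>

lemma chebyshev_bounds:
  fixes w :: real
  assumes "0 \<le> w" "w \<le> 1"
  shows "0 \<le> w * (w - 3 / 4)\<^sup>2" and "w * (w - 3 / 4)\<^sup>2 \<le> 1 / 16"
proof -
  show "0 \<le> w * (w - 3 / 4)\<^sup>2" using assms by simp
  have "1 / 16 - w * (w - 3 / 4)\<^sup>2 = (1 - w) * (w - 1 / 4)\<^sup>2"
    by (simp add: field_simps power2_eq_square)
  also have "\<dots> \<ge> 0" using assms by simp
  finally show "w * (w - 3 / 4)\<^sup>2 \<le> 1 / 16" by simp
qed

lemma abs_radial_error_le_max:
  "t \<in> {-1..1} \<Longrightarrow> \<bar>radial_error \<phi> t \<xi> \<eta>\<bar> \<le> max_radial_error \<phi> \<xi> \<eta>"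
  using max_radial_error_attained[of \<phi> \<xi> \<eta>] by auto

section \<open>Rigidity and optimality of the Chebyshev candidate\<close>

lemma chebyshev_unique:
  fixes a b c s x y :: real
  assumes "0 \<le> c" "0 < s" "0 < a" "0 < b" "0 < c + x"
    and at1: "(c + a)\<^sup>2 \<le> (c + x)\<^sup>2"
    and at2: "(c + 3 / 4 * x)\<^sup>2 + 1 / 4 * (s + 3 / 4 * y)\<^sup>2
            \<le> (c + 3 / 4 * a)\<^sup>2 + 1 / 4 * (s + 3 / 4 * b)\<^sup>2"
    and at3: "(c + a / 4)\<^sup>2 + 3 / 4 * (s + b / 4)\<^sup>2 \<le> (c + x / 4)\<^sup>2 + 3 / 4 * (s + y / 4)\<^sup>2"
  shows "x = a \<and> y = b"
proof -
  have ax: "a \<le> x"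
    using power2_le_imp_le[OF at1] assms by simp
  then have "(c + 3 / 4 * a)\<^sup>2 \<le> (c + 3 / 4 * x)\<^sup>2"
    using assms by (intro power_mono) auto
  with at2 have "(s + 3 / 4 * y)\<^sup>2 \<le> (s + 3 / 4 * b)\<^sup>2" by simp
  from power2_le_imp_le[OF this] have yb: "y \<le> b" using assms by simp
  \<comment> \<open>The weights 3 and 1 below cancel the terms in \<open>y\<^sup>2\<close> and those
    in \<open>c * x\<close>; the rest, \<open>T\<close>, is a sum of terms whose signs are known
    from \<open>a \<le> x\<close> and \<open>y \<le> b\<close>.\<close>
  define F G where "F = (c + x / 4)\<^sup>2 + 3 / 4 * (s + y / 4)\<^sup>2 - ((c + a / 4)\<^sup>2 + 3 / 4 * (s + b / 4)\<^sup>2)"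
    and "G = (c + 3 / 4 * a)\<^sup>2 + 1 / 4 * (s + 3 / 4 * b)\<^sup>2 - ((c + 3 / 4 * x)\<^sup>2 + 1 / 4 * (s + 3 / 4 * y)\<^sup>2)"
  define T where "T = a * (x - a) + (x - a)\<^sup>2 / 2 + s * (b - y)"
  have "3 * F + G = - (3 / 4) * T"
    unfolding F_def G_def T_def by (simp add: field_simps power2_eq_square)
  moreover have "0 \<le> F" "0 \<le> G"
    unfolding F_def G_def diff_ge_0_iff_ge by (fact at3 at2)+
  ultimately have le: "a * (x - a) + (x - a)\<^sup>2 / 2 + s * (b - y) \<le> 0"
    unfolding T_def[symmetric] by linarith
  have nn: "0 \<le> a * (x - a)" "0 \<le> (x - a)\<^sup>2 / 2" "0 \<le> s * (b - y)"
    using assms ax yb by auto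
  from le nn have "a * (x - a) = 0" "s * (b - y) = 0" by linarith+
  then show ?thesis using assms by simp
qed

text \<open>
  For \<open>c = 0\<close> the mirror image of the optimal approximant also satisfies the equations on \<open>a\<close> and
  \<open>b\<close>; it is excluded by \<open>\<xi> > 0\<close>, which enters as positivity of the abscissa at \<open>t = 0\<close>.
\<close>

lemma optimal_iff_chebyshev:
  fixes \<phi> \<xi> \<eta> :: real
  defines "c \<equiv> cos \<phi>" and "s \<equiv> sin \<phi>"
  defines "a \<equiv> 3 * (\<xi> - c) / 4" and "b \<equiv> (3 * \<eta> - s) / 4"
  assumes c: "0 \<le> c" and s: "0 < s" and a: "0 < a" and b: "0 < b"
    and e1: "a\<^sup>2 = 2 * s * b + b\<^sup>2 / 2"
    and e2: "2 * c * a + 2 * s * b - s\<^sup>2 = - (9 / 16) * b\<^sup>2"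
  shows "optimal_inner_approximant \<phi> x y \<longleftrightarrow> x = \<xi> \<and> y = \<eta>"
proof -
  have sc: "s\<^sup>2 + c\<^sup>2 = 1" by (simp add: s_def c_def)
  have E: "radial_error \<phi> t \<xi> \<eta> = - (b\<^sup>2 * ((1 - t\<^sup>2) * ((1 - t\<^sup>2) - 3 / 4)\<^sup>2))" for t
    using radial_error_chebyshev[OF sc e1 e2, of t]
    unfolding radial_error_eq a_def b_def c_def s_def by (simp add: algebra_simps)
  have bounds: "radial_error \<phi> t \<xi> \<eta> \<le> 0" "\<bar>radial_error \<phi> t \<xi> \<eta>\<bar> \<le> b\<^sup>2 / 16"
    if "t \<in> {-1..1}" for t
  proof -
    have "0 \<le> 1 - t\<^sup>2" "1 - t\<^sup>2 \<le> 1"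
      using that by (auto simp: abs_square_le_1 abs_le_iff)
    note B = chebyshev_bounds[OF this]
    show "radial_error \<phi> t \<xi> \<eta> \<le> 0" unfolding E using B(1) by simp
    have "b\<^sup>2 * ((1 - t\<^sup>2) * ((1 - t\<^sup>2) - 3 / 4)\<^sup>2) \<le> b\<^sup>2 * (1 / 16)"
      using B(2) by (rule mult_left_mono) simp
    then show "\<bar>radial_error \<phi> t \<xi> \<eta>\<bar> \<le> b\<^sup>2 / 16"
      unfolding E abs_minus_cancel abs_of_nonneg[OF mult_nonneg_nonneg[OF zero_le_power2 B(1)]] by simp
  qed
  have "0 < \<xi>" using a c by (simp add: a_def)
  then have inner: "inner_approximant \<phi> \<xi> \<eta>"
    unfolding inner_approximant_def using bounds(1) by blast
  have max: "max_radial_error \<phi> \<xi> \<eta> \<le> b\<^sup>2 / 16"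
    using max_radial_error_attained[of \<phi> \<xi> \<eta>] bounds(2) by auto
  \<comment> \<open>Comparing with any competitor of no larger error yields minimality as well as
    uniqueness: a strictly better one would coincide with the candidate.\<close>
  have uniq: "x = \<xi> \<and> y = \<eta>"
    if inn: "inner_approximant \<phi> x y" and le: "max_radial_error \<phi> x y \<le> max_radial_error \<phi> \<xi> \<eta>"
    for x y
  proof -
    define x' y' where "x' = 3 * (x - c) / 4" and "y' = (3 * y - s) / 4"
    have R: "radial_error \<phi> t x y = (c + x' * (1 - t\<^sup>2))\<^sup>2 + t\<^sup>2 * (s + y' * (1 - t\<^sup>2))\<^sup>2 - 1" for t
      unfolding radial_error_eq x'_def y'_def c_def s_def by simp
    have R0: "radial_error \<phi> t \<xi> \<eta> = (c + a * (1 - t\<^sup>2))\<^sup>2 + t\<^sup>2 * (s + b * (1 - t\<^sup>2))\<^sup>2 - 1" for t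
      unfolding radial_error_eq a_def b_def c_def s_def by simp
    have lower: "- (b\<^sup>2 / 16) \<le> radial_error \<phi> t x y" if "t \<in> {-1..1}" for t
      using abs_radial_error_le_max[OF that, of \<phi> x y] le max by linarith
    \<comment> \<open>The parameters 0, 1/2 and sqrt 3 / 2 correspond to w = 1, 3/4 and 1/4, where
      the candidate's error is minimal, zero and minimal.\<close>
    have q: "(sqrt 3 / 2)\<^sup>2 = 3 / 4" by (simp add: power_divide)
    have h: "(1 / 2 :: real)\<^sup>2 = 1 / 4" by (simp add: power_divide)
    have "sqrt 3 \<le> 2" by (rule real_le_lsqrt) auto
    then have t3: "sqrt 3 / 2 \<in> {-1..1}"
      by (auto intro: order_trans[of _ 0])
    have "- (b\<^sup>2 / 16) = radial_error \<phi> 0 \<xi> \<eta>" unfolding E by (simp add: power2_eq_square)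
    with lower[of 0] have 1: "(c + a)\<^sup>2 \<le> (c + x')\<^sup>2" unfolding R R0 by simp
    have "radial_error \<phi> (1 / 2) \<xi> \<eta> = 0" unfolding E h by simp
    moreover have "radial_error \<phi> (1 / 2) x y \<le> 0"
      using inn by (simp add: inner_approximant_def)
    ultimately have 2: "(c + 3 / 4 * x')\<^sup>2 + 1 / 4 * (s + 3 / 4 * y')\<^sup>2
        \<le> (c + 3 / 4 * a)\<^sup>2 + 1 / 4 * (s + 3 / 4 * b)\<^sup>2"
      unfolding R R0 h by (simp add: mult.commute)
    have "- (b\<^sup>2 / 16) = radial_error \<phi> (sqrt 3 / 2) \<xi> \<eta>"
      unfolding E q by (simp add: power2_eq_square)
    with lower[OF t3]
    have 3: "(c + a / 4)\<^sup>2 + 3 / 4 * (s + b / 4)\<^sup>2 \<le> (c + x' / 4)\<^sup>2 + 3 / 4 * (s + y' / 4)\<^sup>2"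
      unfolding R R0 q by simp
    have "0 < c + x'" using inn c by (simp add: inner_approximant_def x'_def field_simps)
    from chebyshev_unique[OF c s a b this 1 2 3] show ?thesis
      by (simp add: x'_def y'_def a_def b_def)
  qed
  show ?thesis
  proof
    assume "optimal_inner_approximant \<phi> x y"
    then show "x = \<xi> \<and> y = \<eta>"
      using uniq inner unfolding optimal_inner_approximant_def by blast
  next
    have "optimal_inner_approximant \<phi> \<xi> \<eta>"
      unfolding optimal_inner_approximant_def using inner uniq by (metis linear)
    then show "optimal_inner_approximant \<phi> x y" if "x = \<xi> \<and> y = \<eta>" using that by simp
  qed
qed

section \<open>Elimination leading to \<open>g1\<close> and \<open>g2\<close>\<close>

text \<open>
  In terms of \<open>a = 3 (\<xi> - c) / 4\<close>, eliminating \<open>b\<^sup>2\<close> from the two equations gives \<open>2 s b = K c a\<close>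
  for the following \<open>K\<close>, and inserting this in the first one gives \<open>K c a (9 a + 16 c) = 8 s\<^sup>2 a\<close>
  after division by \<open>a\<close>.
\<close>

definition K :: "real \<Rightarrow> real \<Rightarrow> real" where
  "K c a = 9 * a\<^sup>2 + 16 * c * a - 8 * (1 - c\<^sup>2)"

lemma g1_eq:
  "g1 c (c + 4 / 3 * a) = 64 * (K c a * (9 * a + 16 * c) - 8 * (1 - c\<^sup>2) * a)"
  unfolding g1_def K_def by (simp add: field_simps power2_eq_square power3_eq_cube)

lemma g2_eq:
  assumes "s = sqrt (1 - c\<^sup>2)" "c\<^sup>2 \<le> 1"
  shows "g2 c (c + 4 / 3 * a) ((4 * b + s) / 3) = 16 / 3 * s * (K c a - 2 * s * b)"
proof -
  have s2: "1 - c\<^sup>2 = s\<^sup>2" using assms by simp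
  \<comment> \<open>Writing 40 as \<open>40 * (s\<^sup>2 + c\<^sup>2)\<close> turns the next step
    into a polynomial identity.\<close>
  have "g2 c (c + 4 / 3 * a) ((4 * b + s) / 3)
      = - 8 * s\<^sup>2 * ((4 * b + s) / 3)
        + s * (27 * (c + 4 / 3 * a)\<^sup>2 + 10 * c * (c + 4 / 3 * a) + 3 * c\<^sup>2 - 40 * (s\<^sup>2 + c\<^sup>2))"
    using assms s2 unfolding g2_def by simp
  also have "\<dots> = 16 / 3 * s * (9 * a\<^sup>2 + 16 * c * a - 8 * s\<^sup>2 - 2 * s * b)"
    by (simp add: field_simps power2_eq_square)
  finally show ?thesis unfolding K_def s2 .
qed

section \<open>The zero of \<open>g1\<close> in the interval I\<close>

lemma K_strict_mono:
  assumes "0 \<le> c" "0 < a" "a < a'"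
  shows "K c a < K c a'"
proof -
  have "a\<^sup>2 < a'\<^sup>2" "c * a \<le> c * a'"
    using assms by (auto intro!: power_strict_mono mult_left_mono)
  then show ?thesis unfolding K_def by simp
qed

text \<open>For positive \<open>a\<close> the quotient of \<open>g1 c (c + 4 / 3 * a)\<close> by
  \<open>a\<close> is strictly increasing; the proof shows this cross-multiplied.\<close>

lemma g1_unique_zero:
  assumes "0 \<le> c" "c < 1" "0 < a" "0 < a'"
    and "g1 c (c + 4 / 3 * a) = 0" "g1 c (c + 4 / 3 * a') = 0"
  shows "a = a'"
proof -
  have False if less: "u < v" and u: "0 < u"
    and zero: "g1 c (c + 4 / 3 * u) = 0" "g1 c (c + 4 / 3 * v) = 0" for u v
  proof -
    have "c\<^sup>2 \<le> 1" using assms by (simp add: power_le_one)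
    have "u * (K c v * (9 * v + 16 * c) - 8 * (1 - c\<^sup>2) * v)
        - v * (K c u * (9 * u + 16 * c) - 8 * (1 - c\<^sup>2) * u)
        = (v - u) * (u * v * (81 * (u + v) + 288 * c) + 128 * c * (1 - c\<^sup>2))"
      unfolding K_def by (simp add: field_simps power2_eq_square)
    moreover have "u * v * (81 * (u + v) + 288 * c) + 128 * c * (1 - c\<^sup>2) > 0"
      using assms less u \<open>c\<^sup>2 \<le> 1\<close> by (intro add_pos_nonneg mult_pos_pos mult_nonneg_nonneg) auto
    ultimately show False using zero less unfolding g1_eq by simp
  qed
  then show ?thesis using assms by (metis linorder_neqE_linordered_idom)
qed

text \<open>Completing the square in \<open>K c a\<close> shows that the left end of I is its
  positive root, so I encodes positivity of \<open>a\<close> and of b = K / (2 s). The right end is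
  \<open>a = 1 - c\<close>.\<close>

lemma xi_interval_iff:
  assumes "0 \<le> c" "c < 1"
  shows "c + 4 / 3 * a \<in> xi_interval c \<longleftrightarrow> 0 < a \<and> 0 < K c a \<and> a < 1 - c"
proof -
  have c2: "c\<^sup>2 < 1" using assms by (simp add: power_less_one_iff)
  define r where "r = 8 * sqrt 2 * sqrt (9 - c\<^sup>2)"
  have r2: "r\<^sup>2 = 128 * (9 - c\<^sup>2)"
    using c2 by (simp add: r_def power_mult_distrib)
  have r0: "0 \<le> r" using c2 by (simp add: r_def)
  have "(32 * c)\<^sup>2 < r\<^sup>2"
    unfolding r2 power_mult_distrib using c2 by simp
  then have rc: "32 * c < r" using r0 by (rule power2_less_imp_less)
  have K: "16 * 9 * K c a = (36 * a + 32 * c)\<^sup>2 - r\<^sup>2"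
    unfolding r2 K_def by (simp add: field_simps power2_eq_square)
  have "c + 4 / 3 * a \<in> xi_interval c \<longleftrightarrow> r < 36 * a + 32 * c \<and> a < 1 - c"
    unfolding xi_interval_def r_def[symmetric] by (auto simp: field_simps)
  moreover have "r < 36 * a + 32 * c \<longleftrightarrow> 0 < a \<and> 0 < K c a"
  proof
    assume lt: "r < 36 * a + 32 * c"
    then have "r\<^sup>2 < (36 * a + 32 * c)\<^sup>2" using r0 by (intro power_strict_mono) auto
    with K lt rc show "0 < a \<and> 0 < K c a" by linarith
  next
    assume "0 < a \<and> 0 < K c a"
    with K assms have "r\<^sup>2 < (36 * a + 32 * c)\<^sup>2" "0 \<le> 36 * a + 32 * c" by auto
    then show "r < 36 * a + 32 * c" by (rule power2_less_imp_less)
  qed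
  ultimately show ?thesis by blast
qed

text \<open>At the positive root of \<open>K c\<close> only the negative term of \<open>g1\<close>
  survives, while at \<open>1 - c\<close> its value is 64 (1 - c)^3; a zero lies between.\<close>

lemma g1_zero_exists:
  assumes "0 \<le> c" "c < 1"
  obtains a where "0 < a" "0 < K c a" "a < 1 - c" "g1 c (c + 4 / 3 * a) = 0"
proof -
  have c2: "c\<^sup>2 < 1" using assms by (simp add: power_less_one_iff)
  have K0: "K c 0 < 0" unfolding K_def using c2 by simp
  have K1: "K c (1 - c) = (1 - c)\<^sup>2" unfolding K_def by algebra
  have "\<exists>a\<ge>0. a \<le> 1 - c \<and> K c a = 0"
  proof (rule IVT')
    show "continuous_on {0..1 - c} (K c)"
      unfolding K_def by (intro continuous_intros)
  qed (use K0 K1 assms in auto)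
  then obtain a0 where a0: "0 \<le> a0" "a0 \<le> 1 - c" "K c a0 = 0" by blast
  have "a0 \<noteq> 0" "a0 \<noteq> 1 - c" using a0 K0 K1 assms by auto
  with a0 have a0': "0 < a0" "a0 < 1 - c" by auto
  define h where "h = (\<lambda>a. g1 c (c + 4 / 3 * a))"
  have "h a0 = - (512 * (1 - c\<^sup>2) * a0)" unfolding h_def g1_eq a0(3) by simp
  then have h0: "h a0 < 0" using c2 a0' by simp
  have "h (1 - c) = 64 * (1 - c) ^ 3"
    unfolding h_def g1_eq K1 by algebra
  then have h1: "0 < h (1 - c)" using assms by simp
  have "\<exists>a\<ge>a0. a \<le> 1 - c \<and> h a = 0"
    using h0 h1 a0' by (intro IVT') (auto simp: h_def g1_def intro!: continuous_intros)
  then obtain a where a: "a0 \<le> a" "a \<le> 1 - c" "h a = 0" by blast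
  have "a \<noteq> a0" "a \<noteq> 1 - c" using a h0 h1 by auto
  with a have "a0 < a" "a < 1 - c" by auto
  moreover from this have "0 < K c a" using K_strict_mono[of c a0 a] a0 a0' assms by simp
  ultimately show thesis using that[of a] a(3) a0' unfolding h_def by simp
qed

theorem theorem4:
  fixes \<phi> c :: real
  assumes "0 < \<phi>" and "\<phi> \<le> pi / 2" and "c = cos \<phi>"
  shows "\<exists>\<xi> \<eta>.
     \<xi> \<in> xi_interval c \<and> g1 c \<xi> = 0 \<and> (\<forall>x\<in>xi_interval c. g1 c x = 0 \<longrightarrow> x = \<xi>) \<and>
     \<eta> \<in> eta_interval c \<and> g2 c \<xi> \<eta> = 0 \<and> (\<forall>y\<in>eta_interval c. g2 c \<xi> y = 0 \<longrightarrow> y = \<eta>) \<and>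
     (\<forall>x y. optimal_inner_approximant \<phi> x y \<longleftrightarrow> x = \<xi> \<and> y = \<eta>)"
proof -
  define s where "s = sin \<phi>"
  have s: "0 < s" unfolding s_def using assms by (intro sin_gt_zero) auto
  have c0: "0 \<le> c" unfolding assms(3) using assms by (intro cos_ge_zero) auto
  have sc: "s\<^sup>2 = 1 - c\<^sup>2" by (simp add: s_def assms(3) sin_squared_eq)
  have c1: "c < 1"
    using cos_monotone_0_pi[of 0 \<phi>] assms by simp
  have sq: "s = sqrt (1 - c\<^sup>2)" using s sc by (metis real_sqrt_unique less_imp_le)
  have c2: "c\<^sup>2 \<le> 1" using c0 c1 by (simp add: power_le_one)
  obtain a where a: "0 < a" "0 < K c a" "a < 1 - c" "g1 c (c + 4 / 3 * a) = 0"
    using g1_zero_exists[OF c0 c1] .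
  \<comment> \<open>This is the solution of the \<open>g2\<close> equation, which is linear in
    \<open>b\<close>.\<close>
  define b where "b = K c a / (2 * s)"
  define \<xi> \<eta> where "\<xi> = c + 4 / 3 * a" and "\<eta> = (4 * b + s) / 3"
  have b: "0 < b" and Kb: "K c a = 2 * s * b" using a s by (auto simp: b_def)
  have g2_iff: "g2 c \<xi> y = 0 \<longleftrightarrow> y = \<eta>" for y
  proof -
    have y: "(4 * ((3 * y - s) / 4) + s) / 3 = y" by (simp add: field_simps)
    have "g2 c \<xi> y = 16 / 3 * s * (K c a - 2 * s * ((3 * y - s) / 4))"
      using g2_eq[OF sq c2, of a "(3 * y - s) / 4"] unfolding y \<xi>_def .
    also have "\<dots> = 0 \<longleftrightarrow> (3 * y - s) / 4 = b" using s unfolding Kb by auto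
    also have "\<dots> \<longleftrightarrow> y = \<eta>" by (auto simp: \<eta>_def field_simps)
    finally show ?thesis .
  qed
  have \<xi>_in: "\<xi> \<in> xi_interval c"
    unfolding \<xi>_def xi_interval_iff[OF c0 c1] using a by blast
  have \<xi>_unique: "x = \<xi>" if "x \<in> xi_interval c" "g1 c x = 0" for x
  proof -
    define a' where "a' = 3 * (x - c) / 4"
    have x: "x = c + 4 / 3 * a'" by (simp add: a'_def field_simps)
    have "a' = a"
      using that a g1_unique_zero[OF c0 c1, of a' a] xi_interval_iff[OF c0 c1, of a']
      unfolding x by blast
    then show ?thesis by (simp add: x \<xi>_def)
  qed
  \<comment> \<open>Since s^2 = (1 - c)(1 + c), the bound \<open>a < 1 - c\<close> becomes 2 b (1 +
    c) < s (1 - c), the upper end of J; the lower end is \<open>0 < b\<close>.\<close>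
  have "K c a < K c (1 - c)" using K_strict_mono c0 a by blast
  also have "K c (1 - c) = (1 - c)\<^sup>2" unfolding K_def by algebra
  finally have "2 * s * b * (1 + c) < (1 - c)\<^sup>2 * (1 + c)"
    unfolding Kb using c0 by (intro mult_strict_right_mono) auto
  also have "\<dots> = s * (s * (1 - c))" using sc by algebra
  finally have "s * (2 * b * (1 + c)) < s * (s * (1 - c))" by (simp add: algebra_simps)
  then have "2 * b * (1 + c) < s * (1 - c)" using s by simp
  then have \<eta>_in: "\<eta> \<in> eta_interval c"
    unfolding eta_interval_def sq[symmetric] \<eta>_def using b c0 by (auto simp: field_simps)
  \<comment> \<open>The factor \<open>a\<close> restores what the elimination divided out: a (9 a +
    16 c) = K + 8 s^2, and K = 2 s b then gives \<open>e1\<close>.\<close>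
  have "a * (K c a * (9 * a + 16 * c) - 8 * s\<^sup>2 * a) = 0"
    using a(4) unfolding g1_eq sc by simp
  then have "K c a * (K c a + 8 * s\<^sup>2) = 8 * s\<^sup>2 * a\<^sup>2"
    unfolding K_def sc by (simp add: algebra_simps power2_eq_square)
  then have "s\<^sup>2 * (8 * a\<^sup>2) = s\<^sup>2 * (4 * b\<^sup>2 + 16 * s * b)"
    unfolding Kb by (simp add: algebra_simps power2_eq_square)
  then have e1: "a\<^sup>2 = 2 * s * b + b\<^sup>2 / 2" using s by simp
  have e2: "2 * c * a + 2 * s * b - s\<^sup>2 = - (9 / 16) * b\<^sup>2"
    using e1 Kb unfolding K_def sc[symmetric] by algebra
  have ab: "3 * (\<xi> - c) / 4 = a" "(3 * \<eta> - s) / 4 = b"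
    by (simp_all add: \<xi>_def \<eta>_def field_simps)
  have "optimal_inner_approximant \<phi> x y \<longleftrightarrow> x = \<xi> \<and> y = \<eta>" for x y
    using optimal_iff_chebyshev[of \<phi> \<xi> \<eta> x y, folded assms(3) s_def, unfolded ab]
      c0 s a(1) b e1 e2 by blast
  then show ?thesis
    using \<xi>_in \<xi>_unique \<eta>_in g2_iff a(4) by (metis \<xi>_def)
qed

end
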